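(* Let $\mathbb{G}$ be $\mathbb{R}$, $\mathbb{C}$ or the quaternions $\mathbb{Q}$, and let $\hat{\mathbb{G}}$ be the corresponding ring of dual elements. Let $A = A_s + A_d\epsilon \in \hat{\mathbb{G}}^{n\times n}$ be a dual Hermitian matrix, and let $\lambda_1,\dots,\lambda_n$ be its $n$ dual number eigenvalues. Let $\phi(\lambda) = \det(\lambda I - A)$ be its characteristic polynomial, where $\lambda$ ranges over dual numbers. Then $$\phi(\lambda) \equiv (\lambda-\lambda_1)\cdots(\lambda-\lambda_n).$$ Furthermore, a dual number $\lambda = \lambda_s + \lambda_d\epsilon$ is a root of $\phi$ (i.e. $\phi(\lambda)=0$) either if $\lambda$ is an eigenvalue of $A$, or if $\lambda_s$ is a multiple eigenvalue of $A_s$.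
   Context: $\mathbb{Q}$ denotes the ring of (real) quaternions. For $\mathbb{G}\in\{\mathbb{R},\mathbb{C},\mathbb{Q}\}$, $\hat{\mathbb{G}}=\{a_s+a_d\epsilon : a_s,a_d\in\mathbb{G}\}$, where $\epsilon^2=0$, $\epsilon\neq 0$, and $\epsilon$ commutes with all elements of $\mathbb{G}$; $a_s$ is the standard part and $a_d$ the dual part. Elements of $\hat{\mathbb{R}}$ are called dual numbers. Matrices and vectors over $\hat{\mathbb{G}}$ are written $A=A_s+A_d\epsilon$, $\mathbf{x}=\mathbf{x}_s+\mathbf{x}_d\epsilon$ with $A_s,A_d,\mathbf{x}_s,\mathbf{x}_d$ over $\mathbb{G}$. Conjugation is $(a_s+a_d\epsilon)^*=a_s^*+a_d^*\epsilon$ (trivial on $\mathbb{R}$), and $A^*$ is the conjugate transpose. $A\in\hat{\mathbb{G}}^{n\times n}$ is dual Hermitian if $A^*=A$, and dual unitary if $A^*=A^{-1}$. A vector $\mathbf{x}\in\hat{\mathbb{G}}^n$ is appreciable if $\mathbf{x}_s\neq\mathbf{0}$. An element $\lambda\in\hat{\mathbb{G}}$ is an eigenvalue of the dual Hermitian matrix $A$ if $A\mathbf{x}=\mathbf{x}\lambda$ for some appreciable $\mathbf{x}\in\hat{\mathbb{G}}^n$; all such $\lambda$ are dual numbers (and hence $A\mathbf{x}=\lambda\mathbf{x}$). It is known that an $n\times n$ dual Hermitian matrix has exactly $n$ dual number eigenvalues, counted with multiplicity: there is a dual unitary $U$ with $U^*AU=\mathrm{diag}(\lambda_1,\dots,\lambda_n)$,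 the $\lambda_i$ being dual numbers unique up to order. Similarly, the Hermitian matrix $A_s\in\mathbb{G}^{n\times n}$ has $n$ real (right) eigenvalues counted with multiplicity; an eigenvalue of $A_s$ is multiple if its multiplicity is at least $2$. The determinant of a dual Hermitian matrix $A$ with eigenvalues $\lambda_1,\dots,\lambda_n$ (counted with multiplicity) is defined as $\det(A)=\lambda_1\lambda_2\cdots\lambda_n$. For a dual number $\lambda$, $\lambda I-A$ is again dual Hermitian, and the characteristic polynomial of $A$ is $\phi(\lambda)=\det(\lambda I-A)$ with this definition of $\det$. *)

theory Defs
  imports "HOL-Analysis.Analysis"
begin

section \<open>Rings with conjugation\<close>

class conj_ring = ring_1 +
  fixes conjg :: "'a \<Rightarrow> 'a"
  assumes conjg_add: "conjg (x + y) = conjg x + conjg y"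
    and conjg_mult: "conjg (x * y) = conjg y * conjg x"
    and conjg_conjg: "conjg (conjg x) = x"

instantiation real :: conj_ring
begin
definition "conjg (x :: real) = x"
instance by standard (simp_all add: conjg_real_def)
end

instantiation complex :: conj_ring
begin
definition "conjg (x :: complex) = cnj x"
instance by standard (simp_all add: conjg_complex_def)
end


section \<open>Real quaternions\<close>

datatype quat = Quat (Q1: real) (Qi: real) (Qj: real) (Qk: real)

lemma quat_eq_iff: "p = q \<longleftrightarrow> Q1 p = Q1 q \<and> Qi p = Qi q \<and> Qj p = Qj q \<and> Qk p = Qk q"
  by (auto intro: quat.expand)

instantiation quat :: "{ring_1, real_algebra_1, conj_ring}"
begin

definition "0 = Quat 0 0 0 0"
definition "1 = Quat 1 0 0 0"
definition "p + q = Quat (Q1 p + Q1 q) (Qi p + Qi q) (Qj p + Qj q) (Qk p + Qk q)"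
definition "p - q = Quat (Q1 p - Q1 q) (Qi p - Qi q) (Qj p - Qj q) (Qk p - Qk q)"
definition "- p = Quat (- Q1 p) (- Qi p) (- Qj p) (- Qk p)"
definition "p * q = Quat
  (Q1 p * Q1 q - Qi p * Qi q - Qj p * Qj q - Qk p * Qk q)
  (Q1 p * Qi q + Qi p * Q1 q + Qj p * Qk q - Qk p * Qj q)
  (Q1 p * Qj q - Qi p * Qk q + Qj p * Q1 q + Qk p * Qi q)
  (Q1 p * Qk q + Qi p * Qj q - Qj p * Qi q + Qk p * Q1 q)"
definition "r *\<^sub>R q = Quat (r * Q1 q) (r * Qi q) (r * Qj q) (r * Qk q)"
definition "conjg q = Quat (Q1 q) (- Qi q) (- Qj q) (- Qk q)"

instance
  by standard
    (simp_all add: quat_eq_iff zero_quat_def one_quat_def plus_quat_def minus_quat_def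
      uminus_quat_def times_quat_def scaleR_quat_def conjg_quat_def algebra_simps)

end


section \<open>Dual elements\<close>

text \<open>\<open>Dual a b\<close> stands for \<open>a + b \<epsilon>\<close>, where \<open>\<epsilon>\<close> is central and \<open>\<epsilon>\<^sup>2 = 0\<close>.\<close>

datatype 'a dual = Dual (std_part: 'a) (dual_part: 'a)

lemma dual_eq_iff: "x = y \<longleftrightarrow> std_part x = std_part y \<and> dual_part x = dual_part y"
  by (auto intro: dual.expand)

instantiation dual :: (ring_1) ring_1
begin

definition "0 = Dual 0 0"
definition "1 = Dual 1 0"
definition "x + y = Dual (std_part x + std_part y) (dual_part x + dual_part y)"
definition "x - y = Dual (std_part x - std_part y) (dual_part x - dual_part y)"
definition "- x = Dual (- std_part x) (- dual_part x)"
definition "x * y = Dual (std_part x * std_part y)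
  (std_part x * dual_part y + dual_part x * std_part y)"

instance
  by standard
    (simp_all add: dual_eq_iff zero_dual_def one_dual_def plus_dual_def minus_dual_def
      uminus_dual_def times_dual_def algebra_simps)

end

instance dual :: (comm_ring_1) comm_ring_1
  by standard (simp_all add: dual_eq_iff one_dual_def plus_dual_def times_dual_def algebra_simps)

instantiation dual :: (conj_ring) conj_ring
begin
definition "conjg x = Dual (conjg (std_part x)) (conjg (dual_part x))"
instance
  by standard
    (simp_all add: dual_eq_iff conjg_dual_def plus_dual_def times_dual_def
      conjg_add conjg_mult conjg_conjg add.commute)
end

text \<open>Dual numbers (\<open>real dual\<close>) as elements of the dual ring over a real algebra.\<close>

definition of_dual_number :: "real dual \<Rightarrow> 'a::real_algebra_1 dual" where
  "of_dual_number x = Dual (of_real (std_part x)) (of_real (dual_part x))"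


section \<open>Matrices\<close>

definition conj_transpose :: "'a::conj_ring^'n^'m \<Rightarrow> 'a^'m^'n" where
  "conj_transpose A = (\<chi> i j. conjg (A $ j $ i))"

text \<open>For entries in a dual ring the next two notions are ``dual Hermitian'' and ``dual unitary''.\<close>

definition hermitian :: "'a::conj_ring^'n^'n \<Rightarrow> bool" where
  "hermitian A \<longleftrightarrow> conj_transpose A = A"

definition unitary :: "'a::conj_ring^'n^'n \<Rightarrow> bool" where
  "unitary U \<longleftrightarrow> conj_transpose U ** U = mat 1 \<and> U ** conj_transpose U = mat 1"

definition diag_mat :: "('n \<Rightarrow> 'a::zero) \<Rightarrow> 'a^'n^'n" where
  "diag_mat d = (\<chi> i j. if i = j then d i else 0)"

definition std_mat :: "'a dual^'n^'m \<Rightarrow> 'a^'n^'m" where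
  "std_mat A = (\<chi> i j. std_part (A $ i $ j))"


section \<open>Eigenvalues\<close>

definition appreciable :: "'a::zero dual^'n \<Rightarrow> bool" where
  "appreciable x \<longleftrightarrow> (\<chi> i. std_part (x $ i)) \<noteq> 0"

text \<open>Right eigenvalues: the scalar multiplies the vector from the right.\<close>

definition dual_eigenvalue :: "'a::ring_1 dual^'n^'n \<Rightarrow> 'a dual \<Rightarrow> bool" where
  "dual_eigenvalue A \<mu> \<longleftrightarrow> (\<exists>x. appreciable x \<and> A *v x = (\<chi> i. x $ i * \<mu>))"

text \<open>
  The family \<open>l\<close> enumerates, with multiplicity and in some order, the dual number eigenvalues
  of the dual Hermitian matrix \<open>A\<close>; similarly below for the real eigenvalues of a
  Hermitian matrix over the base ring.
\<close>

definition dual_eigenvalues ::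
    "'a::{conj_ring, real_algebra_1} dual^'n^'n \<Rightarrow> ('n \<Rightarrow> real dual) \<Rightarrow> bool" where
  "dual_eigenvalues A l \<longleftrightarrow>
    (\<exists>U. unitary U \<and> conj_transpose U ** A ** U = diag_mat (\<lambda>i. of_dual_number (l i)))"

definition real_eigenvalues ::
    "'a::{conj_ring, real_algebra_1}^'n^'n \<Rightarrow> ('n \<Rightarrow> real) \<Rightarrow> bool" where
  "real_eigenvalues A m \<longleftrightarrow>
    (\<exists>U. unitary U \<and> conj_transpose U ** A ** U = diag_mat (\<lambda>i. of_real (m i)))"

definition multiple_eigenvalue ::
    "'a::{conj_ring, real_algebra_1}^'n^'n \<Rightarrow> real \<Rightarrow> bool" where
  "multiple_eigenvalue A r \<longleftrightarrow> (\<exists>m. real_eigenvalues A m \<and> card {i. m i = r} \<ge> 2)"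


section \<open>Determinant and characteristic polynomial\<close>

text \<open>
  Meaningful for dual Hermitian \<open>A\<close> only; there the eigenvalues exist and are unique up to order.
\<close>

definition dual_det :: "'a::{conj_ring, real_algebra_1} dual^'n^'n \<Rightarrow> real dual" where
  "dual_det A = (THE d. \<exists>l. dual_eigenvalues A l \<and> d = (\<Prod>i\<in>UNIV. l i))"

definition dual_charpoly ::
    "'a::{conj_ring, real_algebra_1} dual^'n^'n \<Rightarrow> real dual \<Rightarrow> real dual" where
  "dual_charpoly A x = dual_det (mat (of_dual_number x) - A)"

end

theory Submission
  imports Defs
begin

text \<open>
  If two unitary matrices diagonalise \<open>A\<close> to \<open>diag l\<close> and \<open>diag l'\<close>, then a unitary \<open>W\<close>
  satisfies \<open>diag l W = W diag l'\<close>, so that \<open>l i = l' j\<close> whenever the standard part of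
  \<open>W i j\<close> is nonzero.  The matrix of the squared moduli of these standard parts is doubly
  stochastic and, for every \<open>c\<close>, is supported on blocks matching \<open>l = c\<close> with \<open>l' = c\<close>; summing
  over such a block in two ways shows that \<open>l\<close> and \<open>l'\<close> take the value \<open>c\<close> equally often.  Hence
  the determinant is well defined, and the formula for the characteristic polynomial follows by
  shifting the eigenvalues.  Finally, a product of dual numbers vanishes iff some factor does or
  two of the factors are infinitesimal.
\<close>

section \<open>Conjugation and matrices\<close>

text \<open>Common ground of the three base rings, so that the main results are proved only once:
  both products of \<open>x\<close> with its conjugate are the same real scalar, the squared
  modulus.\<close>

class conj_normed_ring = conj_ring + real_algebra_1 +
  assumes conjg_self_scaleR: "\<exists>r. conjg x * x = r *\<^sub>R 1 \<and> x * conjg x = r *\<^sub>R 1"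

instance real :: conj_normed_ring
  by standard (auto simp: conjg_real_def)

instance complex :: conj_normed_ring
proof
  fix x :: complex
  show "\<exists>r. conjg x * x = r *\<^sub>R 1 \<and> x * conjg x = r *\<^sub>R 1"
    by (rule exI[of _ "(cmod x)\<^sup>2"])
      (simp add: conjg_complex_def scaleR_conv_of_real complex_norm_square mult.commute del: of_real_power)
qed

instance quat :: conj_normed_ring
proof
  fix x :: quat
  show "\<exists>r. conjg x * x = r *\<^sub>R 1 \<and> x * conjg x = r *\<^sub>R 1"
    by (rule exI[of _ "(Q1 x)\<^sup>2 + (Qi x)\<^sup>2 + (Qj x)\<^sup>2 + (Qk x)\<^sup>2"])
      (simp add: quat_eq_iff conjg_quat_def times_quat_def scaleR_quat_def
        one_quat_def power2_eq_square)
qed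

lemma conjg_zero [simp]: "conjg (0::'a::conj_ring) = 0"
  using conjg_add[of "0::'a" 0] by simp

lemma conjg_sum: "conjg (sum f S) = (\<Sum>i\<in>S. conjg (f i :: 'a::conj_ring))"
  by (induction S rule: infinite_finite_induct) (simp_all add: conjg_add)

lemma conj_transpose_matrix_mult:
  "conj_transpose (A ** B) = conj_transpose B ** conj_transpose (A :: 'a::conj_ring^'n^'m)"
  by (simp add: conj_transpose_def matrix_matrix_mult_def vec_eq_iff conjg_sum conjg_mult)

lemma conj_transpose_conj_transpose [simp]: "conj_transpose (conj_transpose A) = A"
  by (simp add: conj_transpose_def vec_eq_iff conjg_conjg)

lemma unitary_conj_transpose: "unitary U \<Longrightarrow> unitary (conj_transpose U)"
  by (simp add: unitary_def)

lemma unitary_matrix_mult: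
  assumes "unitary U" "unitary V"
  shows "unitary (U ** V)"
  using assms unfolding unitary_def conj_transpose_matrix_mult
  by (metis matrix_mul_assoc matrix_mul_rid)

lemma diag_mat_mult_nth: "(diag_mat d ** (W :: 'a::semiring_1^'m^'n)) $ i $ j = d i * W $ i $ j"
  by (simp add: diag_mat_def matrix_matrix_mult_def if_distrib[of "\<lambda>x. x * _"] cong: if_cong)

lemma mult_diag_mat_nth: "((W :: 'a::semiring_1^'n^'m) ** diag_mat d) $ i $ j = W $ i $ j * d j"
  by (simp add: diag_mat_def matrix_matrix_mult_def if_distrib[of "\<lambda>x. _ * x"] cong: if_cong)

lemma diag_mat_mult_vec_nth: "(diag_mat d *v (w :: 'a::semiring_1^'n)) $ i = d i * w $ i"
  by (simp add: diag_mat_def matrix_vector_mult_def if_distrib[of "\<lambda>x. x * _"] cong: if_cong)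

section \<open>Comparison of two unitary diagonalisations\<close>

lemma unitary_diagonalization_left:
  assumes "unitary U" "conj_transpose U ** A ** U = D"
  shows "conj_transpose U ** A = D ** conj_transpose U"
  using assms unfolding unitary_def by (metis matrix_mul_assoc matrix_mul_rid)

lemma unitary_diagonalization_right:
  assumes "unitary U" "conj_transpose U ** A ** U = D"
  shows "A ** U = U ** D"
  using assms unfolding unitary_def by (metis matrix_mul_assoc matrix_mul_lid)

lemma unitary_diagonalizations_intertwine:
  assumes "unitary U" "conj_transpose U ** A ** U = D"
    and "unitary V" "conj_transpose V ** A ** V = D'"
  obtains W where "unitary W" "D ** W = W ** D'"
proof
  \<comment> \<open>With U* for the conjugate transpose, the witness is W = U* V, and D U* V = U* A
    V = U* V D'.\<close>
  show "unitary (conj_transpose U ** V)"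
    using assms by (simp add: unitary_matrix_mult unitary_conj_transpose)
  show "D ** (conj_transpose U ** V) = conj_transpose U ** V ** D'"
    using unitary_diagonalization_left[OF assms(1,2)] unitary_diagonalization_right[OF assms(3,4)]
    by (metis matrix_mul_assoc)
qed

lemma conj_normed_ring_norm_sq:
  obtains N :: "'a::conj_normed_ring \<Rightarrow> real"
  where "\<And>x. conjg x * x = of_real (N x)" "\<And>x. x * conjg x = of_real (N x)" "N 0 = 0"
proof -
  obtain N :: "'a \<Rightarrow> real" where N: "\<And>x. conjg x * x = of_real (N x) \<and> x * conjg x = of_real (N x)"
    using conjg_self_scaleR unfolding of_real_def by metis
  moreover have "N 0 = 0"
    using N[of 0] by simp
  ultimately show thesis
    using that by blast
qed

text \<open>The squared moduli summed over the block \<open>f i = c\<close>, \<open>g j = c\<close>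
  count its rows and also its columns, because every full row and column sums to 1 and entries
  outside matching blocks vanish.\<close>

lemma card_eq_if_unitary_support:
  fixes W :: "'a::conj_normed_ring^'n^'n"
  assumes "unitary W" and supp: "\<And>i j. W $ i $ j \<noteq> 0 \<Longrightarrow> f i = g j"
  shows "card {i. f i = c} = card {j. g j = c}"
proof -
  obtain N :: "'a \<Rightarrow> real" where N: "\<And>x. conjg x * x = of_real (N x)"
      "\<And>x. x * conjg x = of_real (N x)" "N 0 = 0"
    using conj_normed_ring_norm_sq by blast
  have row: "(\<Sum>j\<in>UNIV. N (W $ i $ j)) = 1" for i
  proof -
    have "(W ** conj_transpose W) $ i $ i = 1"
      using assms(1) by (simp add: unitary_def mat_def)
    then have "of_real (\<Sum>j\<in>UNIV. N (W $ i $ j)) = (of_real 1 :: 'a)"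
      by (simp add: matrix_matrix_mult_def conj_transpose_def N)
    then show ?thesis
      by (simp only: of_real_eq_iff)
  qed
  have col: "(\<Sum>i\<in>UNIV. N (W $ i $ j)) = 1" for j
  proof -
    have "(conj_transpose W ** W) $ j $ j = 1"
      using assms(1) by (simp add: unitary_def mat_def)
    then have "of_real (\<Sum>i\<in>UNIV. N (W $ i $ j)) = (of_real 1 :: 'a)"
      by (simp add: matrix_matrix_mult_def conj_transpose_def N)
    then show ?thesis
      by (simp only: of_real_eq_iff)
  qed
  have zero: "N (W $ i $ j) = 0" if "f i \<noteq> g j" for i j
    using supp[of i j] that N(3) by metis
  have "real (card {i. f i = c}) = (\<Sum>i\<in>{i. f i = c}. \<Sum>j\<in>UNIV. N (W $ i $ j))"
    by (simp add: row)
  also have "\<dots> = (\<Sum>i\<in>{i. f i = c}. \<Sum>j\<in>{j. g j = c}. N (W $ i $ j))"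
    by (intro sum.cong sum.mono_neutral_right) (auto intro!: zero)
  also have "\<dots> = (\<Sum>j\<in>{j. g j = c}. \<Sum>i\<in>{i. f i = c}. N (W $ i $ j))"
    by (rule sum.swap)
  also have "\<dots> = (\<Sum>j\<in>{j. g j = c}. \<Sum>i\<in>UNIV. N (W $ i $ j))"
    by (intro sum.cong sum.mono_neutral_left) (auto intro!: zero)
  also have "\<dots> = real (card {j. g j = c})"
    by (simp add: col)
  finally show ?thesis
    by simp
qed

text \<open>Equal counts make the multisets of values equal, and the product depends only on that
  multiset.\<close>

lemma prod_eq_if_card_eq:
  fixes f g :: "'n::finite \<Rightarrow> 'a::comm_monoid_mult"
  assumes "\<And>c. card {i. f i = c} = card {j. g j = c}"
  shows "prod f UNIV = prod g UNIV"
proof -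
  have "image_mset f (mset_set UNIV) = image_mset g (mset_set UNIV)"
    using assms by (intro multiset_eqI) (simp add: count_image_mset_eq_card_vimage)
  then show ?thesis
    by (simp add: prod_unfold_prod_mset)
qed

section \<open>Dual eigenvalues\<close>

lemma dual_sel [simp]:
  "std_part (0 :: 'a::ring_1 dual) = 0" "dual_part (0 :: 'a dual) = 0"
  "std_part (1 :: 'a dual) = 1" "dual_part (1 :: 'a dual) = 0"
  "std_part (x + y) = std_part x + std_part (y :: 'a dual)"
  "dual_part (x + y) = dual_part x + dual_part y"
  "std_part (x - y) = std_part x - std_part y"
  "dual_part (x - y) = dual_part x - dual_part y"
  "std_part (x * y) = std_part x * std_part y"
  "dual_part (x * y) = std_part x * dual_part y + dual_part x * std_part y"
  by (simp_all add: zero_dual_def one_dual_def plus_dual_def minus_dual_def times_dual_def)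

lemma std_part_sum: "std_part (sum f S) = (\<Sum>i\<in>S. std_part (f i :: 'a::ring_1 dual))"
  by (induction S rule: infinite_finite_induct) simp_all

lemma std_part_prod: "std_part (prod f S) = (\<Prod>i\<in>S. std_part (f i :: 'a::comm_ring_1 dual))"
  by (induction S rule: infinite_finite_induct) simp_all

lemma of_dual_number_sel [simp]:
  "std_part (of_dual_number x) = of_real (std_part x)"
  "dual_part (of_dual_number x) = of_real (dual_part x)"
  by (simp_all add: of_dual_number_def)

lemma of_dual_number_commute: "of_dual_number x * y = y * of_dual_number x"
  by (simp add: dual_eq_iff of_real_def)

lemma of_dual_number_diff: "of_dual_number (x - y) = of_dual_number x - of_dual_number y"
  by (simp add: dual_eq_iff)

text \<open>Dual numbers are central, so \<open>a - b\<close> annihilates \<open>w\<close>. The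
  standard part of this equation gives equal standard parts; the dual part then reduces to a real
  multiple of \<open>std_part w\<close>.\<close>

lemma of_dual_number_mult_eq_imp_eq:
  fixes w :: "'a::real_algebra_1 dual"
  assumes eq: "of_dual_number a * w = w * of_dual_number b" and "std_part w \<noteq> 0"
  shows "a = b"
proof -
  have "of_dual_number (a - b) * w = 0"
    using eq by (simp add: of_dual_number_diff left_diff_distrib of_dual_number_commute[of b])
  then have std: "(std_part a - std_part b) *\<^sub>R std_part w = 0"
    and dual: "(std_part a - std_part b) *\<^sub>R dual_part w
      + (dual_part a - dual_part b) *\<^sub>R std_part w = 0"
    by (simp_all add: dual_eq_iff of_real_def scaleR_left_diff_distrib left_diff_distrib)
  from std assms(2) have "std_part a = std_part b"
    by simp
  moreover from this dual assms(2) have "dual_part a = dual_part b"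
    by simp
  ultimately show ?thesis
    by (simp add: dual_eq_iff)
qed

section \<open>Passage to standard parts of matrices\<close>

lemma std_mat_matrix_mult: "std_mat (A ** B) = std_mat A ** std_mat (B :: 'a::ring_1 dual^'n^'m)"
  by (simp add: std_mat_def matrix_matrix_mult_def vec_eq_iff std_part_sum)

lemma std_mat_conj_transpose: "std_mat (conj_transpose A) = conj_transpose (std_mat A)"
  by (simp add: std_mat_def conj_transpose_def vec_eq_iff conjg_dual_def)

lemma std_mat_mat_one: "std_mat (mat 1 :: 'a::ring_1 dual^'n^'n) = mat 1"
  by (simp add: std_mat_def mat_def vec_eq_iff)

lemma unitary_std_mat: "unitary U \<Longrightarrow> unitary (std_mat U)"
  unfolding unitary_def by (metis std_mat_matrix_mult std_mat_conj_transpose std_mat_mat_one)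

lemma real_eigenvalues_std_mat:
  assumes "dual_eigenvalues A l"
  shows "real_eigenvalues (std_mat A) (\<lambda>i. std_part (l i))"
proof -
  obtain U where U: "unitary U" "conj_transpose U ** A ** U = diag_mat (\<lambda>i. of_dual_number (l i))"
    using assms by (auto simp: dual_eigenvalues_def)
  have "std_mat (conj_transpose U ** A ** U) = diag_mat (\<lambda>i. of_real (std_part (l i)))"
    by (simp add: U std_mat_def diag_mat_def vec_eq_iff)
  then show ?thesis
    unfolding real_eigenvalues_def
    using unitary_std_mat[OF U(1)] by (metis std_mat_matrix_mult std_mat_conj_transpose)
qed

section \<open>Uniqueness of multiplicities\<close>

lemma dual_eigenvalues_unique:
  fixes A :: "'a::conj_normed_ring dual^'n^'n"
  assumes "dual_eigenvalues A l" "dual_eigenvalues A l'"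
  shows "card {i. l i = c} = card {j. l' j = c}"
proof -
  obtain W :: "'a dual^'n^'n" where W: "unitary W"
    "diag_mat (\<lambda>i. of_dual_number (l i)) ** W = W ** diag_mat (\<lambda>i. of_dual_number (l' i))"
    using assms unitary_diagonalizations_intertwine unfolding dual_eigenvalues_def by metis
  \<comment> \<open>Moduli are taken in \<open>std_mat W\<close>, over the base ring, while the
    compared families keep their dual parts.\<close>
  have "l i = l' j" if "std_mat W $ i $ j \<noteq> 0" for i j
  proof (rule of_dual_number_mult_eq_imp_eq)
    show "of_dual_number (l i) * W $ i $ j = W $ i $ j * of_dual_number (l' j)"
      using W(2) by (metis diag_mat_mult_nth mult_diag_mat_nth)
    show "std_part (W $ i $ j) \<noteq> 0"
      using that by (simp add: std_mat_def)
  qed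
  then show ?thesis
    by (rule card_eq_if_unitary_support[OF unitary_std_mat[OF W(1)]])
qed

lemma real_eigenvalues_unique:
  fixes A :: "'a::conj_normed_ring^'n^'n"
  assumes "real_eigenvalues A m" "real_eigenvalues A m'"
  shows "card {i. m i = r} = card {j. m' j = r}"
proof -
  obtain W :: "'a^'n^'n" where W: "unitary W"
    "diag_mat (\<lambda>i. of_real (m i)) ** W = W ** diag_mat (\<lambda>i. of_real (m' i))"
    using assms unitary_diagonalizations_intertwine unfolding real_eigenvalues_def by metis
  have "m i = m' j" if "W $ i $ j \<noteq> 0" for i j
  proof -
    have "of_real (m i) * W $ i $ j = W $ i $ j * of_real (m' j)"
      using W(2) by (metis diag_mat_mult_nth mult_diag_mat_nth)
    with that show ?thesis
      by (simp add: of_real_def)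
  qed
  then show ?thesis
    by (rule card_eq_if_unitary_support[OF W(1)])
qed

text \<open>Multiplicities do not depend on the diagonalisation, so the one induced by
  \<open>l\<close> decides.\<close>

lemma multiple_eigenvalue_std_mat_iff:
  fixes A :: "'a::conj_normed_ring dual^'n^'n"
  assumes "dual_eigenvalues A l"
  shows "multiple_eigenvalue (std_mat A) r \<longleftrightarrow> card {i. std_part (l i) = r} \<ge> 2"
  unfolding multiple_eigenvalue_def
  using real_eigenvalues_std_mat[OF assms] real_eigenvalues_unique by metis

lemma dual_eigenvalue_of_dual_number_iff:
  fixes A :: "'a::conj_normed_ring dual^'n^'n"
  assumes "dual_eigenvalues A l"
  shows "dual_eigenvalue A (of_dual_number x) \<longleftrightarrow> (\<exists>i. l i = x)"
proof -
  obtain U where U: "unitary U" "conj_transpose U ** A ** U = diag_mat (\<lambda>i. of_dual_number (l i))"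
    using assms by (auto simp: dual_eigenvalues_def)
  let ?D = "diag_mat (\<lambda>i. of_dual_number (l i)) :: 'a dual^'n^'n"
  let ?m = "of_dual_number x :: 'a dual"
  have scale: "M *v (\<chi> i. v $ i * ?m) = (\<chi> i. (M *v v) $ i * ?m)" for M :: "'a dual^'n^'n" and v
    by (simp add: matrix_vector_mult_def vec_eq_iff sum_distrib_right mult.assoc)
  \<comment> \<open>The standard part of \<open>M *v v\<close> depends on \<open>v\<close> only
    through its standard part. Applied to a unitary matrix and its inverse, this transfers
    appreciability both ways.\<close>
  have app: "appreciable v" if "appreciable (M *v v)" for M :: "'a dual^'n^'n" and v
    using that
    by (rule contrapos_pp) (simp add: appreciable_def matrix_vector_mult_def vec_eq_iff std_part_sum)
  show ?thesis
  proof
    assume "dual_eigenvalue A ?m"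
    then obtain v where v: "appreciable v" "A *v v = (\<chi> i. v $ i * ?m)"
      by (auto simp: dual_eigenvalue_def)
    define w where "w = conj_transpose U *v v"
    have "U *v w = v"
      using U(1) by (simp add: w_def unitary_def matrix_vector_mul_assoc)
    with v(1) have "appreciable w"
      using app by metis
    then obtain i where i: "std_part (w $ i) \<noteq> 0"
      by (auto simp: appreciable_def vec_eq_iff)
    have "?D *v w = conj_transpose U *v (A *v v)"
      using unitary_diagonalization_left[OF U] by (simp add: w_def matrix_vector_mul_assoc)
    then have "?D *v w = (\<chi> i. w $ i * ?m)"
      by (simp add: v(2) scale w_def)
    then have "of_dual_number (l i) * w $ i = w $ i * ?m"
      by (metis diag_mat_mult_vec_nth vec_lambda_beta)
    then have "l i = x"
      using i by (rule of_dual_number_mult_eq_imp_eq)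
    then show "\<exists>i. l i = x" ..
  next
    assume "\<exists>i. l i = x"
    then obtain i where i: "l i = x" ..
    define e :: "'a dual^'n" where "e = axis i 1"
    have "appreciable e"
      by (auto simp: e_def appreciable_def vec_eq_iff axis_def)
    moreover have "conj_transpose U *v (U *v e) = e"
      using U(1) by (simp add: unitary_def matrix_vector_mul_assoc)
    ultimately have "appreciable (U *v e)"
      using app by metis
    moreover have "?D *v e = (\<chi> j. e $ j * ?m)"
      using i by (auto simp: vec_eq_iff diag_mat_mult_vec_nth e_def axis_def)
    \<comment> \<open>The chain is A (U e) = U (D e) = U (e m) = (U e) m, with D = \<open>?D\<close>
      and m = \<open>?m\<close>.\<close>
    then have "A *v (U *v e) = (\<chi> j. (U *v e) $ j * ?m)"
      using unitary_diagonalization_right[OF U]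
      by (simp add: matrix_vector_mul_assoc flip: scale)
        (simp flip: matrix_vector_mul_assoc)
    ultimately show "dual_eigenvalue A ?m"
      by (auto simp: dual_eigenvalue_def)
  qed
qed

section \<open>The characteristic polynomial\<close>

lemma dual_det_eq_prod:
  fixes A :: "'a::conj_normed_ring dual^'n^'n"
  assumes "dual_eigenvalues A l"
  shows "dual_det A = prod l UNIV"
  unfolding dual_det_def
proof (rule the_equality)
  fix d assume "\<exists>l. dual_eigenvalues A l \<and> d = (\<Prod>i\<in>UNIV. l i)"
  then show "d = prod l UNIV"
    using prod_eq_if_card_eq dual_eigenvalues_unique[OF assms] by metis
qed (use assms in blast)

text \<open>The same \<open>U\<close> diagonalises the shifted matrix, since a central scalar matrix
  is fixed under conjugation by \<open>U\<close>.\<close>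

lemma dual_eigenvalues_mat_minus:
  assumes "dual_eigenvalues A l"
  shows "dual_eigenvalues (mat (of_dual_number x) - A) (\<lambda>i. x - l i)"
proof -
  obtain U where U: "unitary U" "conj_transpose U ** A ** U = diag_mat (\<lambda>i. of_dual_number (l i))"
    using assms by (auto simp: dual_eigenvalues_def)
  have mat_eq: "mat (of_dual_number x) = diag_mat (\<lambda>i. of_dual_number x)"
    by (simp add: mat_def diag_mat_def)
  have "conj_transpose U ** mat (of_dual_number x) = mat (of_dual_number x) ** conj_transpose U"
    by (simp add: mat_eq vec_eq_iff diag_mat_mult_nth mult_diag_mat_nth of_dual_number_commute)
  then have "conj_transpose U ** mat (of_dual_number x) ** U = mat (of_dual_number x)"
    using U(1) by (metis matrix_mul_assoc matrix_mul_rid unitary_def)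
  moreover have "conj_transpose U ** (mat (of_dual_number x) - A) ** U
      = conj_transpose U ** mat (of_dual_number x) ** U - conj_transpose U ** A ** U"
    by (simp add: matrix_matrix_mult_def vec_eq_iff right_diff_distrib left_diff_distrib
        sum_subtractf)
  ultimately have "conj_transpose U ** (mat (of_dual_number x) - A) ** U
      = diag_mat (\<lambda>i. of_dual_number (x - l i))"
    by (simp add: U(2) of_dual_number_diff) (simp add: mat_def diag_mat_def vec_eq_iff)
  with U(1) show ?thesis
    by (auto simp: dual_eigenvalues_def)
qed

lemma dual_charpoly_eq_prod:
  fixes A :: "'a::conj_normed_ring dual^'n^'n"
  assumes "dual_eigenvalues A l"
  shows "dual_charpoly A x = (\<Prod>i\<in>UNIV. x - l i)"
  unfolding dual_charpoly_def by (rule dual_det_eq_prod[OF dual_eigenvalues_mat_minus[OF assms]])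

text \<open>Two infinitesimals multiply to 0. Conversely, a zero product has an infinitesimal
  factor; if it is the only one, the remaining product has nonzero standard part and can be
  cancelled.\<close>

lemma prod_dual_eq_0_iff:
  fixes f :: "'b \<Rightarrow> 'a::field dual"
  assumes "finite S"
  shows "prod f S = 0 \<longleftrightarrow> (\<exists>i\<in>S. f i = 0) \<or> card {i\<in>S. std_part (f i) = 0} \<ge> 2"
proof
  assume "(\<exists>i\<in>S. f i = 0) \<or> card {i\<in>S. std_part (f i) = 0} \<ge> 2"
  then show "prod f S = 0"
  proof
    assume "\<exists>i\<in>S. f i = 0"
    then show ?thesis
      using assms by (auto simp: prod.remove)
  next
    assume "card {i\<in>S. std_part (f i) = 0} \<ge> 2"
    then obtain T where "T \<subseteq> {i\<in>S. std_part (f i) = 0}" "card T = 2"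
      by (meson obtain_subset_with_card_n)
    then obtain i j where ij: "i \<in> S" "j \<in> S - {i}" "std_part (f i) = 0" "std_part (f j) = 0"
      by (auto simp: card_2_iff)
    then have "prod f S = (f i * f j) * prod f (S - {i} - {j})"
      using assms by (simp add: prod.remove[of S i] prod.remove[of "S - {i}" j] mult.assoc)
    also have "f i * f j = 0"
      using ij by (simp add: dual_eq_iff)
    finally show ?thesis
      by simp
  qed
next
  assume zero: "prod f S = 0"
  show "(\<exists>i\<in>S. f i = 0) \<or> card {i\<in>S. std_part (f i) = 0} \<ge> 2"
  proof (rule disjCI)
    assume "\<not> card {i\<in>S. std_part (f i) = 0} \<ge> 2"
    moreover from zero have "(\<Prod>i\<in>S. std_part (f i)) = 0"
      by (simp flip: std_part_prod)
    then obtain i where i: "i \<in> S" "std_part (f i) = 0"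
      using assms by auto
    ultimately have "card {i\<in>S. std_part (f i) = 0} = 1"
      using assms card_0_eq[of "{i\<in>S. std_part (f i) = 0}"] by fastforce
    then have "{i\<in>S. std_part (f i) = 0} = {i}"
      using i by (metis (mono_tags, lifting) card_1_singletonE mem_Collect_eq singletonD)
    then have "std_part (prod f (S - {i})) \<noteq> 0"
      using assms by (auto simp: std_part_prod)
    moreover have "f i * prod f (S - {i}) = 0"
      using zero assms i by (simp add: prod.remove)
    \<comment> \<open>The dual part of the product is \<open>dual_part (f i)\<close> times the
      nonzero standard part of the rest.\<close>
    ultimately have "f i = 0"
      using i by (simp add: dual_eq_iff)
    with i show "\<exists>i\<in>S. f i = 0"
      by blast
  qed
qed

text \<open>Among the factors \<open>x - l i\<close>, a zero one makes \<open>x\<close> an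
  eigenvalue, and two infinitesimal ones make \<open>std_part x\<close> a multiple
  eigenvalue.\<close>

lemma dual_charpoly_eq_0_iff:
  fixes A :: "'a::conj_normed_ring dual^'n^'n"
  assumes "dual_eigenvalues A l"
  shows "dual_charpoly A x = 0 \<longleftrightarrow>
    dual_eigenvalue A (of_dual_number x) \<or> multiple_eigenvalue (std_mat A) (std_part x)"
  unfolding dual_charpoly_eq_prod[OF assms] dual_eigenvalue_of_dual_number_iff[OF assms]
    multiple_eigenvalue_std_mat_iff[OF assms] prod_dual_eq_0_iff[OF finite_class.finite_UNIV]
  by (simp add: eq_commute[of "std_part x"] eq_commute[of x])

theorem theorem3p1:
  shows
   "(\<forall>(A :: real dual^'n^'n) l. hermitian A \<longrightarrow> dual_eigenvalues A l \<longrightarrow>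
       (\<forall>x. dual_charpoly A x = (\<Prod>i\<in>UNIV. x - l i)) \<and>
       (\<forall>x. dual_charpoly A x = 0 \<longleftrightarrow>
          dual_eigenvalue A (of_dual_number x) \<or> multiple_eigenvalue (std_mat A) (std_part x)))
  \<and> (\<forall>(A :: complex dual^'n^'n) l. hermitian A \<longrightarrow> dual_eigenvalues A l \<longrightarrow>
       (\<forall>x. dual_charpoly A x = (\<Prod>i\<in>UNIV. x - l i)) \<and>
       (\<forall>x. dual_charpoly A x = 0 \<longleftrightarrow>
          dual_eigenvalue A (of_dual_number x) \<or> multiple_eigenvalue (std_mat A) (std_part x)))
  \<and> (\<forall>(A :: quat dual^'n^'n) l. hermitian A \<longrightarrow> dual_eigenvalues A l \<longrightarrow>
       (\<forall>x. dual_charpoly A x = (\<Prod>i\<in>UNIV. x - l i)) \<and>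
       (\<forall>x. dual_charpoly A x = 0 \<longleftrightarrow>
          dual_eigenvalue A (of_dual_number x) \<or> multiple_eigenvalue (std_mat A) (std_part x)))"
  by (intro conjI allI impI dual_charpoly_eq_prod dual_charpoly_eq_0_iff)

end
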